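(* Let $n$ be a positive integer and let $A$ be a real $n\times n$ matrix. If $A$ is normal, then $|||A|||=\operatorname{r}(\operatorname{span}(A)\cap\{x_n=0\})$. If, in addition, $A$ is (tropically) idempotent, then $|||A|||=\operatorname{r}(C_A)$.
   Context: Notation: $[n]=\{1,\dots,n\}$. Tropical operations on $\mathbb{R}$: $a\oplus b=\max\{a,b\}$ and $a\odot b=a+b$. All matrix products are tropical: $(AB)_{ij}=\max_k (a_{ik}+b_{kj})$ and $A^2=AA$. A matrix $A$ is idempotent if $A=A^2$. Normal: a real $n\times n$ matrix $A=(a_{ij})$ is normal if $a_{ii}=0$ and $a_{ij}\le 0$ for all $i,j\in[n]$. Tropical column span: for a real $n\times m$ matrix $A$ with columns $a_1,\dots,a_m\in\mathbb{R}^n$, $$\operatorname{span}(A)=\{\max\{\lambda_1+a_1,\dots,\lambda_m+a_m\}\in\mathbb{R}^n:\ \lambda_1,\dots,\lambda_m\in\mathbb{R}\},$$ where $\lambda+a$ means adding the scalar $\lambda$ to every coordinate of $a$, and maxima are taken coordinatewise. The set $C_A$: for a real $n\times n$ matrix $A=(a_{ij})$ with zero diagonal, $$C_A=\{x\in\mathbb{R}^{n-1}:\ a_{in}\le x_i\le -a_{ni},\ \ a_{ik}\le x_i-x_k\le -a_{ki},\ \text{ for all } i,k\in[n-1],\ i\ne k\}.$$ Identification: $\mathbb{R}^{n-1}$ is identified with the hyperplane $\{x_n=0\}$ of $\mathbb{R}^n$ via $(x_1,\dots,x_{n-1})\mapsto(x_1,\dots,x_{n-1},0)$. Norms and radius: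 for $p\in\mathbb{R}^n$, $||p||=\max_{i,j\in[n]}\{|p_i|,|p_i-p_j|\}$. For $p,q\in\mathbb{R}^n$, $\operatorname{d}(p,q)=\max_{i,j\in[n]}\{|p_i-q_i|,|p_i-q_i-p_j+q_j|\}$, so $\operatorname{d}(p,0)=||p||$. For a subset $S\subset\mathbb{R}^{n-1}\simeq\{x_n=0\}$ containing the origin, the tropical radius is $\operatorname{r}(S)=\sup_{s\in S}\operatorname{d}(s,0)=\sup_{s\in S}||s||$. For a matrix $A=(a_{ij})$, $|||A|||=\max_{i,j}|a_{ij}|$. (When $A$ is normal, both $C_A$ and $\operatorname{span}(A)\cap\{x_n=0\}$ contain the origin.) *)

theory Defs
  imports Jordan_Normal_Form.Matrix "HOL-Library.Extended_Real"
begin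

text \<open>
  Indices run over \<open>{0..<n}\<close>, so the last coordinate of a vector in dimension \<open>n\<close> has index
  \<open>n - 1\<close>. The definitions using \<^term>\<open>Max\<close> are meant for positive dimensions.
\<close>

definition trop_mult :: "real mat \<Rightarrow> real mat \<Rightarrow> real mat" where
  "trop_mult A B = mat (dim_row A) (dim_col B)
     (\<lambda>(i, j). MAX k\<in>{0..<dim_col A}. A $$ (i, k) + B $$ (k, j))"

definition trop_idempotent :: "real mat \<Rightarrow> bool" where
  "trop_idempotent A \<longleftrightarrow> A = trop_mult A A"

definition trop_normal :: "real mat \<Rightarrow> bool" where
  "trop_normal A \<longleftrightarrow> square_mat A \<and> (\<forall>i<dim_row A. A $$ (i, i) = 0) \<and>
     (\<forall>i<dim_row A. \<forall>j<dim_col A. A $$ (i, j) \<le> 0)"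

definition trop_span :: "real mat \<Rightarrow> real vec set" where
  "trop_span A = {vec (dim_row A) (\<lambda>i. MAX j\<in>{0..<dim_col A}. l $ j + A $$ (i, j)) | l.
     l \<in> carrier_vec (dim_col A)}"

text \<open>Intended for square matrices; the elements have dimension \<open>n - 1\<close>.\<close>

definition C_set :: "real mat \<Rightarrow> real vec set" where
  "C_set A = (let m = dim_row A - 1 in
     {x \<in> carrier_vec m.
        (\<forall>i<m. A $$ (i, m) \<le> x $ i \<and> x $ i \<le> - A $$ (m, i)) \<and>
        (\<forall>i<m. \<forall>k<m. i \<noteq> k \<longrightarrow> A $$ (i, k) \<le> x $ i - x $ k \<and> x $ i - x $ k \<le> - A $$ (k, i))})"

definition last_zero :: "nat \<Rightarrow> real vec set" where
  "last_zero n = {x \<in> carrier_vec n. x $ (n - 1) = 0}"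

text \<open>The identification of \<open>(n - 1)\<close>-dimensional space with \<open>last_zero n\<close>.\<close>

definition embed_last_zero :: "real vec \<Rightarrow> real vec" where
  "embed_last_zero x = x @\<^sub>v 0\<^sub>v 1"

definition trop_norm :: "real vec \<Rightarrow> real" where
  "trop_norm p = Max (\<Union>i\<in>{0..<dim_vec p}. \<Union>j\<in>{0..<dim_vec p}. {\<bar>p $ i\<bar>, \<bar>p $ i - p $ j\<bar>})"

definition trop_dist :: "real vec \<Rightarrow> real vec \<Rightarrow> real" where
  "trop_dist p q = Max (\<Union>i\<in>{0..<dim_vec p}. \<Union>j\<in>{0..<dim_vec p}.
     {\<bar>p $ i - q $ i\<bar>, \<bar>p $ i - q $ i - p $ j + q $ j\<bar>})"

lemma trop_dist_zero: "trop_dist p (0\<^sub>v (dim_vec p)) = trop_norm p"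
  by (simp add: trop_dist_def trop_norm_def)

text \<open>
  The supremum is taken in the extended reals, so that it is the true supremum also for
  unbounded sets.
\<close>

definition trop_radius :: "real vec set \<Rightarrow> ereal" where
  "trop_radius S = (SUP s\<in>S. ereal (trop_dist s (0\<^sub>v (dim_vec s))))"

definition max_norm_mat :: "real mat \<Rightarrow> real" where
  "max_norm_mat A = (MAX (i, j)\<in>{0..<dim_row A} \<times> {0..<dim_col A}. \<bar>A $$ (i, j)\<bar>)"

lemma trop_radius_norm: "trop_radius S = (SUP s\<in>S. ereal (trop_norm s))"
  by (simp add: trop_radius_def trop_dist_zero)

lemma embed_last_zero_bij:
  assumes "0 < n"
  shows "bij_betw embed_last_zero (carrier_vec (n - 1)) (last_zero n)"
  unfolding bij_betw_def
proof
  show "inj_on embed_last_zero (carrier_vec (n - 1))"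
    by (auto simp: inj_on_def embed_last_zero_def)
  show "embed_last_zero ` carrier_vec (n - 1) = last_zero n"
  proof (intro equalityI subsetI)
    fix y assume "y \<in> embed_last_zero ` carrier_vec (n - 1)"
    then show "y \<in> last_zero n"
      using assms by (auto simp: embed_last_zero_def last_zero_def intro!: carrier_vecI)
  next
    fix y assume y: "y \<in> last_zero n"
    have "y = embed_last_zero (vec (n - 1) (\<lambda>i. y $ i))"
    proof (rule eq_vecI)
      fix i assume "i < dim_vec (embed_last_zero (vec (n - 1) (\<lambda>i. y $ i)))"
      then have "i < n - 1 \<or> i = n - 1" by (auto simp: embed_last_zero_def)
      then show "y $ i = embed_last_zero (vec (n - 1) (\<lambda>i. y $ i)) $ i"
        using y by (auto simp: embed_last_zero_def last_zero_def)
    qed (use y assms in \<open>auto simp: embed_last_zero_def last_zero_def\<close>)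
    then show "y \<in> embed_last_zero ` carrier_vec (n - 1)" by auto
  qed
qed

end

theory Submission imports Defs begin

text \<open>
  Let \<open>M\<close> be the largest modulus of an entry of the normal matrix \<open>A\<close>. On the hyperplane
  \<open>x\<^sub>n = 0\<close> each \<open>\<bar>x\<^sub>i\<bar>\<close> is itself the difference \<open>\<bar>x\<^sub>i - x\<^sub>n\<bar>\<close>, so the tropical norm of a point is the
  largest difference of two of its coordinates. Both equalities then follow from two facts about
  the set \<open>S\<close> whose radius is taken.

  \<^item> No two coordinates of a point of \<open>S\<close> differ by more than \<open>M\<close>. For \<open>C_A\<close> the defining
    inequalities say so. For the span, suppose that column \<open>j\<close> attains the maximum defining \<open>x\<^sub>i\<close>;
    the same column gives a lower bound for \<open>x\<^sub>k\<close>, whence \<open>x\<^sub>i - x\<^sub>k \<le> a\<^sub>i\<^sub>j - a\<^sub>k\<^sub>j \<le> - a\<^sub>k\<^sub>j \<le> M\<close>.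
  \<^item> \<open>S\<close> contains every column of \<open>A\<close>, translated along \<open>(1, \<dots>, 1)\<close> into the hyperplane. Coordinates
    \<open>j\<close> and \<open>i\<close> of the translated column \<open>j\<close> differ by \<open>a\<^sub>j\<^sub>j - a\<^sub>i\<^sub>j = \<bar>a\<^sub>i\<^sub>j\<bar>\<close>, so if \<open>a\<^sub>i\<^sub>j\<close> has modulus
    \<open>M\<close>, this column has norm \<open>M\<close>.

  The second fact is where idempotency enters for \<open>C_A\<close>: the difference constraint
  \<open>a\<^sub>i\<^sub>k \<le> a\<^sub>i\<^sub>j - a\<^sub>k\<^sub>j\<close> for the translated column \<open>j\<close> is the triangle inequality
  \<open>a\<^sub>i\<^sub>k + a\<^sub>k\<^sub>j \<le> a\<^sub>i\<^sub>j\<close>, which holds for all \<open>i, j, k\<close> if \<open>A\<^sup>2 = A\<close>.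
\<close>

lemma abs_entry_le_max_norm_mat:
  assumes "A \<in> carrier_mat n m" "i < n" "j < m"
  shows "\<bar>A $$ (i, j)\<bar> \<le> max_norm_mat A"
  using assms unfolding max_norm_mat_def
  by (intro Max_ge) (auto intro!: image_eqI[of _ _ "(i, j)"])

lemma max_norm_mat_attained:
  assumes "A \<in> carrier_mat n m" "0 < n" "0 < m"
  obtains i j where "i < n" "j < m" "max_norm_mat A = \<bar>A $$ (i, j)\<bar>"
proof -
  have "max_norm_mat A \<in> (\<lambda>(i, j). \<bar>A $$ (i, j)\<bar>) ` ({0..<dim_row A} \<times> {0..<dim_col A})"
    unfolding max_norm_mat_def using assms by (intro Max_in) auto
  then show thesis using assms that by auto
qed

lemma abs_diff_le_trop_norm:
  assumes "i < dim_vec x" "j < dim_vec x"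
  shows "\<bar>x $ i - x $ j\<bar> \<le> trop_norm x"
  using assms unfolding trop_norm_def
  by (intro Max_ge) (simp, blast intro: atLeastLessThan_iff[THEN iffD2] le0)

text \<open>
  The entry in the last coordinate is zero, so bounds on the differences also bound
  the moduli of the entries.
\<close>

lemma trop_norm_le:
  assumes "x \<in> last_zero n" "0 < n"
    and diff: "\<And>i k. i < n \<Longrightarrow> k < n \<Longrightarrow> x $ i - x $ k \<le> M"
  shows "trop_norm x \<le> M"
proof -
  have dim: "dim_vec x = n" and last: "x $ (n - 1) = 0"
    using assms(1) by (auto simp: last_zero_def)
  have abs_diff: "\<bar>x $ i - x $ k\<bar> \<le> M" if "i < n" "k < n" for i k
    using diff[OF that] diff[OF that(2,1)] by linarith
  have "\<bar>x $ i\<bar> \<le> M" if "i < n" for i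
    using abs_diff[OF that, of "n - 1"] last \<open>0 < n\<close> by simp
  with abs_diff show ?thesis
    unfolding trop_norm_def dim using \<open>0 < n\<close> by (subst Max_le_iff) auto
qed

definition normalized_column :: "real mat \<Rightarrow> nat \<Rightarrow> real vec" where
  "normalized_column A j =
     vec (dim_row A) (\<lambda>i. A $$ (i, j) - A $$ (dim_row A - 1, j))"

text \<open>
  The common core of both equalities: the differences are bounded by the matrix norm, and the
  translated column through an entry of maximal modulus attains the bound.
\<close>

lemma trop_radius_eq_max_norm_mat:
  assumes "0 < n" and A: "A \<in> carrier_mat n n" and norm: "trop_normal A"
    and sub: "S \<subseteq> last_zero n"
    and diff: "\<And>x i k. x \<in> S \<Longrightarrow> i < n \<Longrightarrow> k < n \<Longrightarrow> x $ i - x $ k \<le> max_norm_mat A"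
    and cols: "\<And>j. j < n \<Longrightarrow> normalized_column A j \<in> S"
  shows "trop_radius S = ereal (max_norm_mat A)"
proof (rule antisym)
  show "trop_radius S \<le> ereal (max_norm_mat A)"
    unfolding trop_radius_norm
  proof (rule SUP_least)
    fix x assume "x \<in> S"
    then show "ereal (trop_norm x) \<le> ereal (max_norm_mat A)"
      using trop_norm_le[of x n "max_norm_mat A"] sub diff \<open>0 < n\<close> by auto
  qed
  obtain i j where ij: "i < n" "j < n" and max: "max_norm_mat A = \<bar>A $$ (i, j)\<bar>"
    using max_norm_mat_attained[OF A] \<open>0 < n\<close> by blast
  have "max_norm_mat A = \<bar>normalized_column A j $ j - normalized_column A j $ i\<bar>"
    using A norm ij max by (simp add: normalized_column_def trop_normal_def)
  also have "\<dots> \<le> trop_norm (normalized_column A j)"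
    using A ij by (intro abs_diff_le_trop_norm) (auto simp: normalized_column_def)
  finally have "ereal (max_norm_mat A) \<le> ereal (trop_norm (normalized_column A j))"
    by simp
  also have "\<dots> \<le> trop_radius S"
    unfolding trop_radius_norm using cols[OF \<open>j < n\<close>] by (rule SUP_upper)
  finally show "ereal (max_norm_mat A) \<le> trop_radius S" .
qed

text \<open>
  The column attaining the maximum in coordinate \<open>i\<close> competes in coordinate \<open>k\<close> with the
  same coefficient, so the coefficients drop out of the difference.
\<close>

lemma trop_span_diff_le:
  assumes A: "A \<in> carrier_mat n n" and norm: "trop_normal A"
    and x: "x \<in> trop_span A" and ik: "i < n" "k < n"
  shows "x $ i - x $ k \<le> max_norm_mat A"
proof -
  obtain l where l: "x = vec n (\<lambda>i. MAX j\<in>{0..<n}. l $ j + A $$ (i, j))"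
    using x A by (auto simp: trop_span_def)
  have "x $ i = (MAX j\<in>{0..<n}. l $ j + A $$ (i, j))"
    using l ik by simp
  also have "\<dots> \<in> (\<lambda>j. l $ j + A $$ (i, j)) ` {0..<n}"
    using ik by (intro Max_in) auto
  finally obtain j where j: "j < n" "x $ i = l $ j + A $$ (i, j)"
    by auto
  have "l $ j + A $$ (k, j) \<le> x $ k"
    using l ik j by auto
  moreover have "A $$ (i, j) \<le> 0"
    using norm A ik j by (auto simp: trop_normal_def)
  moreover have "- A $$ (k, j) \<le> max_norm_mat A"
    using abs_entry_le_max_norm_mat[OF A ik(2) j(1)] by linarith
  ultimately show ?thesis using j by linarith
qed

text \<open>
  The coefficients of a tropical combination are real numbers, so the other columns cannot be
  left out; a coefficient low enough to keep them below column \<open>j\<close> does the same.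
\<close>

lemma normalized_column_in_trop_span:
  assumes A: "A \<in> carrier_mat n n" and norm: "trop_normal A" and j: "j < n"
  shows "normalized_column A j \<in> trop_span A"
proof -
  define c where "c = A $$ (n - 1, j)"
  define l where "l = vec n (\<lambda>k. (if k = j then 0 else - max_norm_mat A) - c)"
  have "(MAX k\<in>{0..<n}. l $ k + A $$ (i, k)) = A $$ (i, j) - c" if i: "i < n" for i
  proof (rule Max_eqI)
    fix y assume "y \<in> (\<lambda>k. l $ k + A $$ (i, k)) ` {0..<n}"
    then obtain k where k: "k < n" "y = l $ k + A $$ (i, k)" by auto
    have "A $$ (i, k) \<le> 0"
      using norm A i k by (auto simp: trop_normal_def)
    moreover have "- max_norm_mat A \<le> A $$ (i, j)"
      using abs_entry_le_max_norm_mat[OF A i j] by linarith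
    ultimately show "y \<le> A $$ (i, j) - c"
      using k by (auto simp: l_def)
  next
    show "A $$ (i, j) - c \<in> (\<lambda>k. l $ k + A $$ (i, k)) ` {0..<n}"
      using j by (intro image_eqI[of _ _ j]) (auto simp: l_def)
  qed simp
  then have "normalized_column A j = vec n (\<lambda>i. MAX k\<in>{0..<n}. l $ k + A $$ (i, k))"
    using A by (auto simp: normalized_column_def c_def)
  moreover have "l \<in> carrier_vec n" by (simp add: l_def)
  ultimately show ?thesis
    using A unfolding trop_span_def by auto
qed

lemma normalized_column_in_last_zero:
  assumes "A \<in> carrier_mat n m" "0 < n"
  shows "normalized_column A j \<in> last_zero n"
  using assms by (auto simp: normalized_column_def last_zero_def)

text \<open>
  With the last coordinate fixed at zero, the bounds on the single coordinates in \<^const>\<open>C_set\<close>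
  become difference constraints against that coordinate, and each upper bound is the lower bound
  for the pair in the opposite order. This leaves one uniform family of constraints.
\<close>

lemma embed_C_set_eq:
  assumes A: "A \<in> carrier_mat n n" and norm: "trop_normal A" and "0 < n"
  shows "embed_last_zero ` C_set A =
    {x \<in> last_zero n. \<forall>i<n. \<forall>k<n. A $$ (i, k) \<le> x $ i - x $ k}"
proof -
  define P where "P x \<longleftrightarrow> (\<forall>i<n. \<forall>k<n. A $$ (i, k) \<le> x $ i - x $ k)" for x :: "real vec"
  have diag: "A $$ (i, i) = 0" if "i < n" for i
    using norm A that by (auto simp: trop_normal_def)
  have C_set_iff: "x \<in> C_set A \<longleftrightarrow> P (embed_last_zero x)" if x: "x \<in> carrier_vec (n - 1)" for x
  proof -
    obtain m where n: "n = Suc m" using \<open>0 < n\<close> by (cases n) auto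
    have front: "embed_last_zero x $ i = x $ i" if "i < m" for i
      using x n that by (auto simp: embed_last_zero_def)
    have last: "embed_last_zero x $ m = 0"
      using x n by (auto simp: embed_last_zero_def)
    have "P (embed_last_zero x) \<longleftrightarrow>
        (\<forall>i<m. \<forall>k<m. A $$ (i, k) \<le> x $ i - x $ k) \<and>
        (\<forall>i<m. A $$ (i, m) \<le> x $ i) \<and> (\<forall>k<m. A $$ (m, k) \<le> - x $ k)"
      using diag[of m] n by (auto simp: P_def All_less_Suc front last)
    also have "\<dots> \<longleftrightarrow> x \<in> C_set A"
    proof
      assume L: "(\<forall>i<m. \<forall>k<m. A $$ (i, k) \<le> x $ i - x $ k) \<and>
        (\<forall>i<m. A $$ (i, m) \<le> x $ i) \<and> (\<forall>k<m. A $$ (m, k) \<le> - x $ k)"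
      have "x $ i \<le> - A $$ (m, i)" if "i < m" for i
        using L that by force
      moreover have "x $ i - x $ k \<le> - A $$ (k, i)" if "i < m" "k < m" for i k
        using L that by force
      ultimately show "x \<in> C_set A"
        using L x A n by (auto simp: C_set_def Let_def)
    next
      assume R: "x \<in> C_set A"
      have "A $$ (i, k) \<le> x $ i - x $ k" if "i < m" "k < m" for i k
        using R that A n diag[of i] by (cases "i = k") (auto simp: C_set_def Let_def)
      moreover have "A $$ (m, k) \<le> - x $ k" if "k < m" for k
        using R that A n by (force simp: C_set_def Let_def)
      ultimately show "(\<forall>i<m. \<forall>k<m. A $$ (i, k) \<le> x $ i - x $ k) \<and>
          (\<forall>i<m. A $$ (i, m) \<le> x $ i) \<and> (\<forall>k<m. A $$ (m, k) \<le> - x $ k)"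
        using R A n by (auto simp: C_set_def Let_def)
    qed
    finally show ?thesis by simp
  qed
  have "C_set A = {x \<in> carrier_vec (n - 1). P (embed_last_zero x)}"
  proof -
    have "C_set A \<subseteq> carrier_vec (n - 1)"
      using A by (auto simp: C_set_def Let_def)
    then show ?thesis
      by (auto simp: C_set_iff)
  qed
  moreover have "embed_last_zero ` carrier_vec (n - 1) = last_zero n"
    using embed_last_zero_bij[OF \<open>0 < n\<close>] by (simp add: bij_betw_def)
  ultimately have "embed_last_zero ` C_set A = {x \<in> last_zero n. P x}"
    by auto
  then show ?thesis by (simp add: P_def)
qed

lemma trop_idempotent_triangle:
  assumes A: "A \<in> carrier_mat n n" and "trop_idempotent A" and "i < n" "j < n" "k < n"
  shows "A $$ (i, k) + A $$ (k, j) \<le> A $$ (i, j)"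
proof -
  have "A $$ (i, k) + A $$ (k, j) \<le> (MAX k\<in>{0..<n}. A $$ (i, k) + A $$ (k, j))"
    using \<open>k < n\<close> by (intro Max_ge) auto
  also have "\<dots> = trop_mult A A $$ (i, j)"
    using A \<open>i < n\<close> \<open>j < n\<close> by (simp add: trop_mult_def)
  also have "\<dots> = A $$ (i, j)"
    using \<open>trop_idempotent A\<close> by (simp add: trop_idempotent_def)
  finally show ?thesis .
qed

theorem theorem8:
  fixes n :: nat and A :: "real mat"
  assumes "n > 0"
    and "A \<in> carrier_mat n n"
    and "trop_normal A"
  shows "ereal (max_norm_mat A) = trop_radius (trop_span A \<inter> last_zero n) \<and>
    (trop_idempotent A \<longrightarrow>
      ereal (max_norm_mat A) = trop_radius (embed_last_zero ` C_set A))"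
proof (intro conjI impI)
  show "ereal (max_norm_mat A) = trop_radius (trop_span A \<inter> last_zero n)"
    using assms trop_span_diff_le normalized_column_in_trop_span normalized_column_in_last_zero
    by (intro trop_radius_eq_max_norm_mat[symmetric]) auto
next
  assume idem: "trop_idempotent A"
  show "ereal (max_norm_mat A) = trop_radius (embed_last_zero ` C_set A)"
    unfolding embed_C_set_eq[OF assms(2,3,1)]
  proof (rule trop_radius_eq_max_norm_mat[OF assms, symmetric])
    fix x i k
    assume x: "x \<in> {x \<in> last_zero n. \<forall>i<n. \<forall>k<n. A $$ (i, k) \<le> x $ i - x $ k}"
      and ik: "i < n" "k < n"
    have "A $$ (k, i) \<le> x $ k - x $ i"
      using x ik by simp
    then show "x $ i - x $ k \<le> max_norm_mat A"
      using abs_entry_le_max_norm_mat[OF assms(2) ik(2,1)] by linarith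
  next
    fix j assume "j < n"
    then have "A $$ (i, k) \<le> normalized_column A j $ i - normalized_column A j $ k"
      if "i < n" "k < n" for i k
      using trop_idempotent_triangle[OF assms(2) idem that(1) _ that(2), of j] that assms(2)
      by (simp add: normalized_column_def)
    then show "normalized_column A j
        \<in> {x \<in> last_zero n. \<forall>i<n. \<forall>k<n. A $$ (i, k) \<le> x $ i - x $ k}"
      using normalized_column_in_last_zero assms by blast
  qed auto
qed

end
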